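(* Every $C_4$-free graph $G\neq K_3$ satisfies $\varphi(G)\ge \chi(G)-2$.
   Context: All graphs are finite, simple and non-empty. $C_4$-free means $G$ contains no cycle of length 4 as a (not necessarily induced) subgraph. For a proper colouring $\sigma$ of $G$, $\varphi_\sigma(G)=\max_{H}\big(|\sigma(V(H))|-\chi(H)\big)$ over all induced subgraphs $H$ of $G$; the chromatic discrepancy is $\varphi(G)=\min_\sigma \varphi_\sigma(G)$ over all proper colourings $\sigma$ of $G$. *)

theory Defs
  imports "Graph_Theory.Graph_Theory"
begin

text \<open>
  The locale \<open>graph\<close> describes finite simple graphs as finite symmetric digraphs without loops
  and parallel arcs: an undirected edge is a pair of opposite arcs.
\<close>

definition c4_free :: "('a, 'b) pre_digraph \<Rightarrow> bool" where
  "c4_free G \<longleftrightarrow> \<not> (\<exists>p. pre_digraph.cycle G p \<and> length p = 4)"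

lemma (in wf_digraph) c4_free_iff:
  "c4_free G \<longleftrightarrow> \<not> (\<exists>a b c d. distinct [a, b, c, d] \<and>
     a \<rightarrow>\<^bsub>G\<^esub> b \<and> b \<rightarrow>\<^bsub>G\<^esub> c \<and> c \<rightarrow>\<^bsub>G\<^esub> d \<and> d \<rightarrow>\<^bsub>G\<^esub> a)"
proof -
  have "(\<exists>p. cycle p \<and> length p = 4) \<longleftrightarrow> (\<exists>a b c d. distinct [a, b, c, d] \<and>
     a \<rightarrow>\<^bsub>G\<^esub> b \<and> b \<rightarrow>\<^bsub>G\<^esub> c \<and> c \<rightarrow>\<^bsub>G\<^esub> d \<and> d \<rightarrow>\<^bsub>G\<^esub> a)" (is "?L \<longleftrightarrow> ?R")
  proof
    assume ?L
    then obtain p u where *: "awalk u p u" "distinct (tl (awalk_verts u p))" "length p = 4"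
      unfolding cycle_def by blast
    from \<open>length p = 4\<close> obtain e f g h where p: "p = [e, f, g, h]"
      by (auto simp: numeral_eq_Suc length_Suc_conv)
    from * have "distinct [u, head G e, head G f, head G g]"
      "u \<rightarrow>\<^bsub>G\<^esub> head G e" "head G e \<rightarrow>\<^bsub>G\<^esub> head G f" "head G f \<rightarrow>\<^bsub>G\<^esub> head G g" "head G g \<rightarrow>\<^bsub>G\<^esub> u"
      unfolding p awalk_def by (auto simp: cas.simps arcs_ends_conv image_iff) metis+
    then show ?R by blast
  next
    assume ?R
    then obtain a b c d where D: "distinct [a, b, c, d]"
      and E: "a \<rightarrow>\<^bsub>G\<^esub> b" "b \<rightarrow>\<^bsub>G\<^esub> c" "c \<rightarrow>\<^bsub>G\<^esub> d" "d \<rightarrow>\<^bsub>G\<^esub> a" by blast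
    from E obtain e f g h where A: "e \<in> arcs G" "f \<in> arcs G" "g \<in> arcs G" "h \<in> arcs G"
      "tail G e = a" "head G e = b" "tail G f = b" "head G f = c"
      "tail G g = c" "head G g = d" "tail G h = d" "head G h = a"
      by (auto simp: arcs_ends_conv)
    have "cycle [e, f, g, h]"
      unfolding cycle_def awalk_def using A D
      by (intro exI[of _ a]) (auto simp: cas.simps)
    then show ?L by (intro exI[of _ "[e, f, g, h]"]) simp
  qed
  then show ?thesis unfolding c4_free_def by simp
qed

text \<open>
  Colours are natural numbers and their number is not bounded in advance. The values of a
  colouring outside of the vertex set are irrelevant.
\<close>

definition proper_colouring :: "('a, 'b) pre_digraph \<Rightarrow> ('a \<Rightarrow> nat) \<Rightarrow> bool" where
  "proper_colouring G \<sigma> \<longleftrightarrow> (\<forall>u v. u \<rightarrow>\<^bsub>G\<^esub> v \<longrightarrow> \<sigma> u \<noteq> \<sigma> v)"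

definition chromatic_number :: "('a, 'b) pre_digraph \<Rightarrow> nat" where
  "chromatic_number G = (LEAST k. \<exists>\<sigma>. proper_colouring G \<sigma> \<and> card (\<sigma> ` verts G) = k)"

definition colouring_discrepancy :: "('a, 'b) pre_digraph \<Rightarrow> ('a \<Rightarrow> nat) \<Rightarrow> int" where
  "colouring_discrepancy G \<sigma> =
    Max {int (card (\<sigma> ` verts H)) - int (chromatic_number H) | H.
      induced_subgraph H G \<and> verts H \<noteq> {}}"

definition chromatic_discrepancy :: "('a, 'b) pre_digraph \<Rightarrow> int" where
  "chromatic_discrepancy G = Min {colouring_discrepancy G \<sigma> | \<sigma>. proper_colouring G \<sigma>}"

text \<open>Every graph has a proper colouring, and the sets under Max and Min above are finite
  and non-empty for non-empty graphs, so that all these extrema are attained.\<close>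

lemma (in graph) finite_induced_subgraphs: "finite {H. induced_subgraph H G}"
proof -
  have "{H. induced_subgraph H G} \<subseteq> (\<lambda>A. G \<restriction> A) ` Pow (verts G)"
  proof
    fix H assume "H \<in> {H. induced_subgraph H G}"
    then have H: "induced_subgraph H G" by simp
    then have "verts H \<subseteq> verts G" by auto
    moreover have "H = G \<restriction> verts H" using H
      by (intro pre_digraph.equality)
        (auto simp: induced_subgraph_def subgraph_def compatible_def arcs_ends_conv)
    ultimately show "H \<in> (\<lambda>A. G \<restriction> A) ` Pow (verts G)" by blast
  qed
  then show ?thesis by (rule finite_subset) simp
qed

lemma (in graph) finite_discrepancy_candidates:
  "finite {int (card (\<sigma> ` verts H)) - int (chromatic_number H) | H.
      induced_subgraph H G \<and> verts H \<noteq> {}}"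
  using finite_induced_subgraphs by auto

lemma (in graph) discrepancy_candidates_nonempty:
  assumes "verts G \<noteq> {}"
  shows "{int (card (\<sigma> ` verts H)) - int (chromatic_number H) | H.
      induced_subgraph H G \<and> verts H \<noteq> {}} \<noteq> {}"
proof -
  have "induced_subgraph (G \<restriction> verts G) G" by blast
  moreover have "verts (G \<restriction> verts G) \<noteq> {}" using assms by simp
  ultimately show ?thesis by blast
qed

lemma (in graph) proper_colouring_exists: "\<exists>\<sigma>. proper_colouring G \<sigma>"
proof -
  obtain \<sigma> :: "'a \<Rightarrow> nat" where "inj_on \<sigma> (verts G)"
    using finite_imp_inj_to_nat_seg finite_verts by metis
  then have "proper_colouring G \<sigma>"
    unfolding proper_colouring_def
    by (metis adj_in_verts(1) adj_in_verts(2) adj_not_same inj_on_contraD)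
  then show ?thesis by blast
qed

lemma (in graph) colouring_discrepancies_nonempty:
  "{colouring_discrepancy G \<sigma> | \<sigma>. proper_colouring G \<sigma>} \<noteq> {}"
  using proper_colouring_exists by blast

lemma (in graph) finite_colouring_discrepancies:
  assumes "verts G \<noteq> {}"
  shows "finite {colouring_discrepancy G \<sigma> | \<sigma>. proper_colouring G \<sigma>}"
proof (rule finite_subset)
  let ?f = "\<lambda>(c, H). int c - int (chromatic_number H)"
  show "{colouring_discrepancy G \<sigma> | \<sigma>. proper_colouring G \<sigma>}
    \<subseteq> ?f ` ({..card (verts G)} \<times> {H. induced_subgraph H G})"
  proof
    fix x assume "x \<in> {colouring_discrepancy G \<sigma> | \<sigma>. proper_colouring G \<sigma>}"
    then obtain \<sigma> where "x = colouring_discrepancy G \<sigma>" by blast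
    with Max_in[OF finite_discrepancy_candidates discrepancy_candidates_nonempty[OF assms], of \<sigma>]
    obtain H where H: "induced_subgraph H G"
      and x: "x = int (card (\<sigma> ` verts H)) - int (chromatic_number H)"
      unfolding colouring_discrepancy_def by auto
    have "verts H \<subseteq> verts G" using H by auto
    then have "card (\<sigma> ` verts H) \<le> card (verts G)"
      by (meson card_image_le card_mono finite_subset finite_verts le_trans)
    with H show "x \<in> ?f ` ({..card (verts G)} \<times> {H. induced_subgraph H G})"
      unfolding x by (intro image_eqI[of _ _ "(card (\<sigma> ` verts H), H)"]) auto
  qed
  show "finite (?f ` ({..card (verts G)} \<times> {H. induced_subgraph H G}))"
    using finite_induced_subgraphs by simp
qed

end

theory Submission
  imports Defs
begin

text \<open>
  Fix a proper colouring \<open>\<sigma>\<close> with \<open>k\<close> colours. We look for a vertex set \<open>Y\<close> that is \<open>h\<close>-colourable,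
  while the graph is \<open>j\<close>-colourable, such that \<open>h + j\<close> exceeds the number of \<open>\<sigma>\<close>-colours on \<open>Y\<close> by
  at most 2.

  Suppose first that \<open>k - 1\<close> colours suffice. Let \<open>v\<close> see the largest number \<open>b\<close> of colours, and
  let \<open>X'\<close> be the set of vertices whose colour is absent from the closed neighbourhood \<open>N[v]\<close>. A
  vertex of the colour of \<open>v\<close> with a neighbour in \<open>X'\<close> misses some colour of \<open>N(v)\<close>, so the colour
  class of \<open>v\<close> can be dissolved and an \<open>i\<close>-colouring of \<open>X'\<close> extends to an \<open>(i + b)\<close>-colouring. On the
  other hand \<open>v\<close> has no neighbour in \<open>X'\<close> and every other vertex has at most one neighbour in
  \<open>N(v)\<close>, so adding \<open>N[v]\<close> to a subset of \<open>X'\<close> brings \<open>b + 1\<close> new colours but costs only one more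
  class, and induction applies.

  If \<open>k - 1\<close> colours do not suffice, every colour class has a vertex that sees all other colours. Two
  such vertices \<open>v\<close>, \<open>w\<close> of different colours have at most one common neighbour, and both
  neighbourhoods induce matchings. Colours can be distributed over \<open>N(v)\<close> and \<open>N(w)\<close> so that both
  parts are independent, because the union of two matchings is bipartite; this gives a bipartite
  subgraph with all \<open>k\<close> colours. The only obstruction is a common neighbour that is alone in its
  colour class. Repeating the argument yields two adjacent singleton classes, which for
  \<open>k \<ge> 4\<close> could be merged.
\<close>

section \<open>Two matchings on one finite set\<close>

text \<open>
  No \<open>M1\<close>-edge lies outside \<open>B\<close> and no \<open>M2\<close>-edge inside: following the alternating path from
  \<open>p\<close>, the \<open>M2\<close>-partner of a vertex in \<open>B\<close> is put outside \<open>B\<close>, and its \<open>M1\<close>-partner inside.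
\<close>

lemma two_matchings:
  fixes M1 M2 :: "'c \<Rightarrow> 'c \<Rightarrow> bool"
  assumes "finite C" and "p \<in> C"
    and sym1: "\<And>x y. M1 x y \<Longrightarrow> M1 y x" and sym2: "\<And>x y. M2 x y \<Longrightarrow> M2 y x"
    and irrefl1: "\<And>x. \<not> M1 x x" and irrefl2: "\<And>x. \<not> M2 x x"
    and uniq1: "\<And>x y z. M1 x y \<Longrightarrow> M1 x z \<Longrightarrow> y = z"
    and uniq2: "\<And>x y z. M2 x y \<Longrightarrow> M2 x z \<Longrightarrow> y = z"
  shows "\<exists>B\<subseteq>C. p \<in> B \<and> (\<forall>x\<in>C - B. \<forall>y\<in>C - B. \<not> M1 x y) \<and> (\<forall>x\<in>B. \<forall>y\<in>B. \<not> M2 x y)"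
  using assms(1,2)
proof (induction C arbitrary: p rule: finite_psubset_induct)
  case (psubset C)
  let ?good = "\<lambda>C B. B \<subseteq> C \<and> (\<forall>x\<in>C - B. \<forall>y\<in>C - B. \<not> M1 x y) \<and> (\<forall>x\<in>B. \<forall>y\<in>B. \<not> M2 x y)"
  \<comment> \<open>The prescribed \<open>r\<close> may lie outside \<open>C'\<close>, and
    \<open>C'\<close> may be empty: the alternating path can end at any point.\<close>
  have IH: "\<exists>B. ?good C' B \<and> (r \<in> C' \<longrightarrow> r \<in> B)" if "C' \<subset> C" for C' r
  proof (cases "C' = {}")
    case True
    then show ?thesis by auto
  next
    case False
    then obtain r' where "r' \<in> C'" "r \<in> C' \<longrightarrow> r' = r" by blast
    with psubset.IH[OF that, of r'] show ?thesis by blast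
  qed
  show ?case
  proof (cases "\<exists>s\<in>C. M2 p s")
    case False
    have "C - {p} \<subset> C" using psubset.prems by blast
    from IH[OF this, of p] obtain B where B: "?good (C - {p}) B" by auto
    show ?thesis
    proof (intro exI[of _ "insert p B"] conjI ballI)
      show "insert p B \<subseteq> C" "p \<in> insert p B" using B psubset.prems by auto
      show "\<not> M1 x y" if "x \<in> C - insert p B" "y \<in> C - insert p B" for x y
        using that B by auto
      have "\<not> M2 p y" "\<not> M2 y p" if "y \<in> C" for y using that False sym2 by metis+
      then show "\<not> M2 x y" if "x \<in> insert p B" "y \<in> insert p B" for x y
        using that B psubset.prems by auto
    qed
  next
    case True
    then obtain s where s: "s \<in> C" "M2 p s" by blast
    have ps: "p \<noteq> s" using s irrefl2 by blast
    obtain r where r: "\<And>y. M1 s y \<Longrightarrow> y = r" using uniq1 by blast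
    obtain B where B: "?good (C - {p, s}) B" "r \<in> C - {p, s} \<longrightarrow> r \<in> B"
      using IH[of "C - {p, s}" r] psubset.prems by blast
    have 1: "\<not> M2 p y" if "y \<in> B" for y using that B(1) s(2) uniq2[of p y s] by auto
    have 2: "\<not> M1 s y" if "y \<in> C - insert p B" for y
    proof
      assume "M1 s y"
      then have "y = r" "y \<noteq> s" using r irrefl1 by auto
      then show False using that B(2) by auto
    qed
    show ?thesis
    proof (intro exI[of _ "insert p B"] conjI ballI)
      show "insert p B \<subseteq> C" "p \<in> insert p B" using B psubset.prems by auto
      show "\<not> M1 x y" if "x \<in> C - insert p B" "y \<in> C - insert p B" for x y
        using that B(1) 2 sym1[of x y] by (cases "x = s"; cases "y = s") auto
      show "\<not> M2 x y" if "x \<in> insert p B" "y \<in> insert p B" for x y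
        using that B(1) 1 sym2[of x y] irrefl2 by auto
    qed
  qed
qed

section \<open>C4-free relations, colourings and neighbourhoods\<close>

text \<open>By \<open>irrefl\<close>, a closed walk of length 4 is a 4-cycle unless opposite
  vertices coincide; hence the form of \<open>c4\<close>. Subsets of vertices stand for induced
  subgraphs, which suits the induction.\<close>

locale c4_free_relation =
  fixes E :: "'a \<Rightarrow> 'a \<Rightarrow> bool"
  assumes sym: "E x y \<Longrightarrow> E y x"
    and irrefl: "\<not> E x x"
    and c4: "E a b \<Longrightarrow> E b c \<Longrightarrow> E c d \<Longrightarrow> E d a \<Longrightarrow> a = c \<or> b = d"
begin

definition proper_on :: "'a set \<Rightarrow> ('a \<Rightarrow> nat) \<Rightarrow> bool" where
  "proper_on X \<tau> \<longleftrightarrow> (\<forall>x\<in>X. \<forall>y\<in>X. E x y \<longrightarrow> \<tau> x \<noteq> \<tau> y)"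

definition colourable :: "'a set \<Rightarrow> nat \<Rightarrow> bool" where
  "colourable X n \<longleftrightarrow> (\<exists>\<tau>. proper_on X \<tau> \<and> \<tau> ` X \<subseteq> {..<n})"

definition indep :: "'a set \<Rightarrow> bool" where
  "indep X \<longleftrightarrow> (\<forall>x\<in>X. \<forall>y\<in>X. \<not> E x y)"

definition matching :: "'a set \<Rightarrow> bool" where
  "matching X \<longleftrightarrow> (\<forall>x\<in>X. \<forall>y\<in>X. \<forall>z\<in>X. E x y \<longrightarrow> E x z \<longrightarrow> y = z)"

lemma proper_onI: "(\<And>x y. x \<in> X \<Longrightarrow> y \<in> X \<Longrightarrow> E x y \<Longrightarrow> \<tau> x \<noteq> \<tau> y) \<Longrightarrow> proper_on X \<tau>"
  by (auto simp: proper_on_def)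

lemma proper_onD: "proper_on X \<tau> \<Longrightarrow> x \<in> X \<Longrightarrow> y \<in> X \<Longrightarrow> E x y \<Longrightarrow> \<tau> x \<noteq> \<tau> y"
  by (auto simp: proper_on_def)

lemma common_neighbour_unique: "E v a \<Longrightarrow> E w a \<Longrightarrow> E v b \<Longrightarrow> E w b \<Longrightarrow> v \<noteq> w \<Longrightarrow> a = b"
  using c4 sym by blast

text \<open>Two neighbours of \<open>x\<close> inside the neighbourhood of \<open>v\<close> would be
  two common neighbours of \<open>x\<close> and \<open>v\<close>.\<close>

lemma matching_neighbourhood: "X \<subseteq> {u. E v u} \<Longrightarrow> matching X"
  unfolding matching_def using common_neighbour_unique irrefl by (metis mem_Collect_eq subsetD)

lemma colourable_mono: "colourable X n \<Longrightarrow> Y \<subseteq> X \<Longrightarrow> n \<le> m \<Longrightarrow> colourable Y m"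
proof -
  assume "colourable X n" and YX: "Y \<subseteq> X" and nm: "n \<le> m"
  then obtain \<tau> where "proper_on X \<tau>" "\<tau> ` X \<subseteq> {..<n}" unfolding colourable_def by blast
  then have "proper_on Y \<tau>" "\<tau> ` Y \<subseteq> {..<m}" using YX nm unfolding proper_on_def by fastforce+
  then show ?thesis unfolding colourable_def by blast
qed

lemma colourable_card:
  assumes "finite X" "proper_on X \<tau>" "card (\<tau> ` X) \<le> n"
  shows "colourable X n"
proof -
  obtain g where g: "bij_betw g (\<tau> ` X) {..<card (\<tau> ` X)}"
    using ex_bij_betw_finite_nat[of "\<tau> ` X"] assms(1) by (auto simp: atLeast0LessThan)
  have "proper_on X (g \<circ> \<tau>)"
    using assms(2) bij_betw_imp_inj_on[OF g] unfolding proper_on_def by (simp add: inj_on_eq_iff)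
  moreover have "(g \<circ> \<tau>) ` X \<subseteq> {..<n}"
    unfolding image_comp[symmetric] bij_betw_imp_surj_on[OF g] using assms(3) by simp
  ultimately show ?thesis unfolding colourable_def by blast
qed

lemma colourable_two:
  assumes "indep I" "indep J"
  shows "colourable (I \<union> J) 2"
  unfolding colourable_def using assms
  by (intro exI[of _ "\<lambda>x. if x \<in> I then 0 else 1"]) (auto simp: proper_on_def indep_def)

lemma colourable_insert:
  assumes "colourable X n"
  shows "colourable (insert x X) (Suc n)"
proof -
  obtain \<tau> where "proper_on X \<tau>" "\<tau> ` X \<subseteq> {..<n}" using assms unfolding colourable_def by blast
  then have "proper_on (insert x X) (\<tau>(x := n))" "(\<tau>(x := n)) ` insert x X \<subseteq> {..<Suc n}"
    unfolding proper_on_def image_subset_iff using irrefl by (auto simp: less_Suc_eq)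
  then show ?thesis unfolding colourable_def by blast
qed

section \<open>Bipartite rainbow sets when no colour can be saved\<close>

text \<open>The edges between chosen representatives form two matchings on the colours, and
  \<open>two_matchings\<close> decides which representative each colour uses. The colour
  \<open>p\<close>, possibly absent from \<open>P\<close>, is served by \<open>Q\<close>.\<close>

lemma rainbow_split:
  fixes \<sigma> :: "'a \<Rightarrow> nat"
  assumes P: "matching P" and Q: "matching Q"
    and "finite C" and CQ: "C \<subseteq> \<sigma> ` Q" and CP: "C \<subseteq> insert p (\<sigma> ` P)"
  obtains I J where "I \<subseteq> P" "J \<subseteq> Q" "indep I" "indep J" "C \<subseteq> \<sigma> ` I \<union> \<sigma> ` J"
proof (cases "C = {}")
  case True
  then show thesis using that[of "{}" "{}"] by (auto simp: indep_def)
next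
  case False
  \<comment> \<open>If \<open>p\<close> is not in \<open>C\<close>, no colour of \<open>C\<close> is
    missing from \<open>P\<close> and any of them may be forced into \<open>B\<close>.\<close>
  define p' where "p' = (if p \<in> C then p else (SOME c. c \<in> C))"
  have p': "p' \<in> C" unfolding p'_def using False by (auto intro: someI_ex)
  have "\<forall>c\<in>C - {p'}. \<exists>x\<in>P. \<sigma> x = c" using CP unfolding p'_def by auto
  then obtain f where f: "\<And>c. c \<in> C - {p'} \<Longrightarrow> f c \<in> P \<and> \<sigma> (f c) = c" by metis
  have "\<forall>c\<in>C. \<exists>x\<in>Q. \<sigma> x = c" using CQ by auto
  then obtain g where g: "\<And>c. c \<in> C \<Longrightarrow> g c \<in> Q \<and> \<sigma> (g c) = c" by metis
  let ?M1 = "\<lambda>x y. x \<in> C - {p'} \<and> y \<in> C - {p'} \<and> E (f x) (f y)"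
  let ?M2 = "\<lambda>x y. x \<in> C \<and> y \<in> C \<and> E (g x) (g y)"
  have "\<exists>B\<subseteq>C. p' \<in> B \<and> (\<forall>x\<in>C - B. \<forall>y\<in>C - B. \<not> ?M1 x y) \<and> (\<forall>x\<in>B. \<forall>y\<in>B. \<not> ?M2 x y)"
  proof (rule two_matchings[OF \<open>finite C\<close> p'])
    show "y = z" if "?M1 x y" "?M1 x z" for x y z
      using that P f unfolding matching_def by metis
    show "y = z" if "?M2 x y" "?M2 x z" for x y z
      using that Q g unfolding matching_def by metis
  qed (auto simp: irrefl intro: sym)
  then obtain B where B: "B \<subseteq> C" "p' \<in> B" "\<forall>x\<in>C - B. \<forall>y\<in>C - B. \<not> ?M1 x y"
    "\<forall>x\<in>B. \<forall>y\<in>B. \<not> ?M2 x y" by blast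
  show thesis
  proof (rule that[of "f ` (C - B)" "g ` B"])
    show "indep (f ` (C - B))" "indep (g ` B)" using B unfolding indep_def by blast+
    show "f ` (C - B) \<subseteq> P" "g ` B \<subseteq> Q" using B f g by blast+
    show "C \<subseteq> \<sigma> ` f ` (C - B) \<union> \<sigma> ` g ` B"
    proof
      fix c assume c: "c \<in> C"
      show "c \<in> \<sigma> ` f ` (C - B) \<union> \<sigma> ` g ` B"
      proof (cases "c \<in> B")
        case True
        then show ?thesis using g[OF c] by (metis UnI2 image_eqI)
      next
        case False
        then have "\<sigma> (f c) = c" using f[of c] c B(2) by blast
        with False c show ?thesis by (metis DiffI UnI1 image_eqI)
      qed
    qed
  qed
qed

text \<open>
  Otherwise recolour \<open>x\<close> by \<open>p\<close> and \<open>y\<close> by \<open>q\<close>; the conflicting neighbours take the old colour of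
  \<open>x\<close>, and two adjacent ones would close a 4-cycle through \<open>x\<close> and \<open>y\<close>.
\<close>

lemma singleton_classes_not_adjacent:
  assumes fin: "finite X" and pr: "proper_on X \<sigma>" and k: "card (\<sigma> ` X) \<ge> 4"
    and crit: "\<not> colourable X (card (\<sigma> ` X) - 1)"
    and x: "x \<in> X" "\<And>z. z \<in> X \<Longrightarrow> \<sigma> z = \<sigma> x \<Longrightarrow> z = x"
    and y: "y \<in> X" "\<And>z. z \<in> X \<Longrightarrow> \<sigma> z = \<sigma> y \<Longrightarrow> z = y"
  shows "\<not> E x y"
proof
  assume xy: "E x y"
  have ne: "\<sigma> x \<noteq> \<sigma> y" using proper_onD[OF pr x(1) y(1) xy] .
  have "\<not> \<sigma> ` X \<subseteq> {\<sigma> x, \<sigma> y}"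
    using k card_mono[of "{\<sigma> x, \<sigma> y}" "\<sigma> ` X"] ne by auto
  then obtain p where p: "p \<in> \<sigma> ` X" "p \<notin> {\<sigma> x, \<sigma> y}" by blast
  have "\<not> \<sigma> ` X \<subseteq> {\<sigma> x, \<sigma> y, p}"
    using k card_mono[of "{\<sigma> x, \<sigma> y, p}" "\<sigma> ` X"] ne p by auto
  then obtain q where q: "q \<in> \<sigma> ` X" "q \<notin> {\<sigma> x, \<sigma> y, p}" by blast
  define M where "M = {s. s \<noteq> x \<and> s \<noteq> y \<and> (\<sigma> s = p \<and> E s x \<or> \<sigma> s = q \<and> E s y)}"
  define \<tau> where "\<tau> s = (if s \<in> M then \<sigma> x else if s = x then p else if s = y then q else \<sigma> s)" for s
  have "proper_on X \<tau>"
  proof (rule proper_onI)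
    fix s t assume st: "s \<in> X" "t \<in> X" "E s t"
    then have ts: "E t s" and d: "\<sigma> s \<noteq> \<sigma> t" using sym proper_onD[OF pr] by blast+
    have "\<not> (s \<in> M \<and> t \<in> M)"
    proof
      assume M: "s \<in> M \<and> t \<in> M"
      then have "E s x \<and> E y t \<or> E t x \<and> E y s" using d sym[of _ y] unfolding M_def by auto
      then show False using c4[of s x y t] c4[of t x y s] xy st(3) ts M unfolding M_def by auto
    qed
    moreover have "\<tau> t \<noteq> \<sigma> x" if "s \<in> M" "t \<notin> M" using that x(2)[OF st(2)] p q d ne
      unfolding \<tau>_def by auto
    moreover have "\<tau> s \<noteq> \<sigma> x" if "t \<in> M" "s \<notin> M" using that x(2)[OF st(1)] p q d ne
      unfolding \<tau>_def by auto
    moreover have "\<tau> s \<noteq> \<tau> t" if M: "t \<notin> M" "s \<notin> M"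
    proof -
      have "\<sigma> u \<noteq> p" if "u \<notin> M" "E u x" "u \<noteq> y" for u using that irrefl unfolding M_def by auto
      moreover have "\<sigma> u \<noteq> q" if "u \<notin> M" "E u y" "u \<noteq> x" for u using that irrefl unfolding M_def by auto
      ultimately show ?thesis
        using M st(3) ts d q irrefl unfolding \<tau>_def by (metis insertI1 insertI2)
    qed
    ultimately show "\<tau> s \<noteq> \<tau> t" unfolding \<tau>_def by (auto split: if_splits)
  qed
  moreover have "\<tau> ` X \<subseteq> \<sigma> ` X - {\<sigma> y}"
    using p q x y ne unfolding \<tau>_def M_def by auto
  then have "card (\<tau> ` X) \<le> card (\<sigma> ` X) - 1"
    using card_mono[of "\<sigma> ` X - {\<sigma> y}" "\<tau> ` X"] fin y(1) by simp
  ultimately show False using crit colourable_card[OF fin] by blast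
qed

text \<open>Known as a b-vertex in the theory of b-colourings.\<close>

definition full :: "'a set \<Rightarrow> ('a \<Rightarrow> nat) \<Rightarrow> 'a \<Rightarrow> bool" where
  "full X \<sigma> v \<longleftrightarrow> v \<in> X \<and> (\<forall>c\<in>\<sigma> ` X. c \<noteq> \<sigma> v \<longrightarrow> (\<exists>u\<in>X. E v u \<and> \<sigma> u = c))"

text \<open>Otherwise each vertex of colour \<open>c\<close> could move to a colour that it does not
  see; the class is independent, so the moves do not interfere.\<close>

lemma full_vertex_exists:
  assumes fin: "finite X" and pr: "proper_on X \<sigma>"
    and crit: "\<not> colourable X (card (\<sigma> ` X) - 1)" and c: "c \<in> \<sigma> ` X"
  shows "\<exists>v. full X \<sigma> v \<and> \<sigma> v = c"
proof (rule ccontr)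
  assume "\<not> ?thesis"
  then have "\<forall>v\<in>X. \<exists>d. \<sigma> v = c \<longrightarrow> d \<in> \<sigma> ` X \<and> d \<noteq> c \<and> (\<forall>u\<in>X. E v u \<longrightarrow> \<sigma> u \<noteq> d)"
    unfolding full_def by metis
  then obtain m where m: "\<And>v. v \<in> X \<Longrightarrow> \<sigma> v = c \<Longrightarrow> m v \<in> \<sigma> ` X \<and> m v \<noteq> c \<and> (\<forall>u\<in>X. E v u \<longrightarrow> \<sigma> u \<noteq> m v)"
    by metis
  define \<tau> where "\<tau> v = (if \<sigma> v = c then m v else \<sigma> v)" for v
  have "proper_on X \<tau>"
    using pr m sym unfolding proper_on_def \<tau>_def by (smt (verit, best))
  moreover have "\<tau> ` X \<subseteq> \<sigma> ` X - {c}" using m unfolding \<tau>_def by auto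
  then have "card (\<tau> ` X) \<le> card (\<sigma> ` X) - 1"
    using card_mono[of "\<sigma> ` X - {c}" "\<tau> ` X"] fin c by simp
  ultimately show False using crit colourable_card[OF fin] by blast
qed

lemma bipartite_rainbow_or_singleton_class:
  assumes fin: "finite X" and pr: "proper_on X \<sigma>"
    and v: "full X \<sigma> v" and w: "full X \<sigma> w" and vw: "\<sigma> v \<noteq> \<sigma> w"
    and no: "\<And>Y. Y \<subseteq> X \<Longrightarrow> colourable Y 2 \<Longrightarrow> \<sigma> ` Y \<noteq> \<sigma> ` X"
  shows "\<exists>q\<in>X. E v q \<and> E w q \<and> (\<forall>z\<in>X. \<sigma> z = \<sigma> q \<longrightarrow> z = q)"
proof -
  have ne: "v \<noteq> w" using vw by blast
  have X: "v \<in> X" "w \<in> X" using v w unfolding full_def by auto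
  have no': False if "I \<subseteq> X" "J \<subseteq> X" "indep I" "indep J" "\<sigma> ` X \<subseteq> \<sigma> ` I \<union> \<sigma> ` J" for I J
    using no[OF _ colourable_two[OF that(3,4)]] that by blast
  have ext: "indep (insert u I)" if "indep I" "\<forall>i\<in>I. \<not> E u i" for u I
    using that sym irrefl unfolding indep_def by blast
  define C where "C = \<sigma> ` X - {\<sigma> v, \<sigma> w}"
  \<comment> \<open>Without the common neighbours, \<open>w\<close> can join an independent part of
    \<open>P\<close> and \<open>v\<close> one of \<open>Q\<close>; this supplies the two colours
    left out of \<open>C\<close>.\<close>
  define P where "P = {u\<in>X. E v u \<and> \<not> E w u}"
  define Q where "Q = {u\<in>X. E w u \<and> \<not> E v u}"
  have P: "matching P" and Q: "matching Q"
    by (rule matching_neighbourhood[of _ v] matching_neighbourhood[of _ w]; auto simp: P_def Q_def)+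
  have finC: "finite C" unfolding C_def using fin by simp
  have cov: "\<exists>u\<in>X. E v u \<and> \<sigma> u = c" "\<exists>u\<in>X. E w u \<and> \<sigma> u = c" if "c \<in> C" for c
    using that v w unfolding C_def full_def by auto
  have fail: False if I: "I \<subseteq> P" "J \<subseteq> Q" "indep I" "indep J" "C \<subseteq> \<sigma> ` I \<union> \<sigma> ` J" for I J
  proof (rule no'[of "insert w I" "insert v J"])
    show "insert w I \<subseteq> X" "insert v J \<subseteq> X" using I X unfolding P_def Q_def by auto
    show "indep (insert w I)" "indep (insert v J)"
      using I unfolding P_def Q_def by (auto intro!: ext)
    show "\<sigma> ` X \<subseteq> \<sigma> ` insert w I \<union> \<sigma> ` insert v J" using I(5) unfolding C_def by auto
  qed
  have failQ: False if S: "C \<subseteq> \<sigma> ` Q" "C \<subseteq> insert p (\<sigma> ` P)" for p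
  proof -
    obtain I J where "I \<subseteq> P" "J \<subseteq> Q" "indep I" "indep J" "C \<subseteq> \<sigma> ` I \<union> \<sigma> ` J"
      using rainbow_split[OF P Q finC S] .
    then show False by (rule fail)
  qed
  have failP: False if S: "C \<subseteq> \<sigma> ` P" "C \<subseteq> insert p (\<sigma> ` Q)" for p
  proof -
    obtain J I where "J \<subseteq> Q" "I \<subseteq> P" "indep J" "indep I" "C \<subseteq> \<sigma> ` J \<union> \<sigma> ` I"
      using rainbow_split[OF Q P finC S] .
    then show False using fail[of I J] by (simp add: Un_commute)
  qed
  have "\<exists>q\<in>X. E v q \<and> E w q"
  proof (rule ccontr)
    assume "\<not> ?thesis"
    then have "C \<subseteq> \<sigma> ` P" "C \<subseteq> \<sigma> ` Q" using cov unfolding P_def Q_def by blast+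
    then show False using failQ by blast
  qed
  then obtain q where q: "q \<in> X" "E v q" "E w q" by blast
  have q_only: "u = q" if "E v u" "E w u" for u
    using common_neighbour_unique that q ne by blast
  have subs: "C - {\<sigma> q} \<subseteq> \<sigma> ` P" "C - {\<sigma> q} \<subseteq> \<sigma> ` Q"
    using cov q_only unfolding P_def Q_def by blast+
  \<comment> \<open>If \<open>P\<close> or \<open>Q\<close> had the colour of \<open>q\<close>, it
    would have all of \<open>C\<close>, and the other would lack at most one colour.\<close>
  have e: "\<sigma> q \<notin> \<sigma> ` P" "\<sigma> q \<notin> \<sigma> ` Q" using failP[of "\<sigma> q"] failQ[of "\<sigma> q"] subs by blast+
  have "z = q" if z: "z \<in> X" "\<sigma> z = \<sigma> q" for z
  proof (rule ccontr)
    assume zq: "z \<noteq> q"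
    have "z \<notin> P" "z \<notin> Q" using e z(2) by (metis imageI)+
    then have zv: "\<not> E v z" and zw: "\<not> E w z" using z(1) zq q_only unfolding P_def Q_def by blast+
    have zne: "v \<noteq> z" using proper_onD[OF pr X(1) q(1,2)] z by auto
    \<comment> \<open>\<open>z\<close> is to join \<open>w\<close> in one part, so its neighbours
      leave \<open>P\<close>. There is at most one, which costs at most one colour, and
      \<open>rainbow_split\<close> tolerates that.\<close>
    define P' where "P' = {u\<in>P. \<not> E z u}"
    define C' where "C' = C - {\<sigma> q}"
    obtain r where r: "\<And>u. E v u \<Longrightarrow> E z u \<Longrightarrow> u = r"
      using common_neighbour_unique zne by metis
    have "C' \<subseteq> insert (\<sigma> r) (\<sigma> ` P')"
    proof
      fix c assume "c \<in> C'"
      then obtain u where "u \<in> P" "c = \<sigma> u" using subs unfolding C'_def by blast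
      then show "c \<in> insert (\<sigma> r) (\<sigma> ` P')" using r[of u] unfolding P'_def P_def by auto
    qed
    moreover have "C' \<subseteq> \<sigma> ` Q" "finite C'" using subs finC unfolding C'_def by auto
    moreover have "matching P'" using P unfolding P'_def matching_def by blast
    ultimately obtain I J where IJ: "I \<subseteq> P'" "J \<subseteq> Q" "indep I" "indep J" "C' \<subseteq> \<sigma> ` I \<union> \<sigma> ` J"
      using rainbow_split[OF _ Q] by metis
    show False
    proof (rule no'[of "insert z (insert w I)" "insert v J"])
      show "insert z (insert w I) \<subseteq> X" "insert v J \<subseteq> X"
        using IJ X z unfolding P'_def P_def Q_def by auto
      have "indep (insert w I)" using IJ unfolding P'_def P_def by (auto intro!: ext)
      moreover have "\<not> E z i" if "i \<in> insert w I" for i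
        using that IJ(1) zw sym[of z w] unfolding P'_def by blast
      ultimately show "indep (insert z (insert w I))" by (simp add: ext)
      show "indep (insert v J)" using IJ unfolding Q_def by (auto intro!: ext)
      show "\<sigma> ` X \<subseteq> \<sigma> ` insert z (insert w I) \<union> \<sigma> ` insert v J"
        using IJ(5) z unfolding C'_def C_def by auto
    qed
  qed
  with q show ?thesis by blast
qed

text \<open>The vertex \<open>q\<close> of the first singleton class is full, being alone in its
  class, so the alternative applies again to \<open>v\<close> and \<open>q\<close>.\<close>

lemma bipartite_rainbow_exists:
  assumes fin: "finite X" and pr: "proper_on X \<sigma>" and k: "card (\<sigma> ` X) \<ge> 4"
    and crit: "\<not> colourable X (card (\<sigma> ` X) - 1)"
  shows "\<exists>Y\<subseteq>X. colourable Y 2 \<and> \<sigma> ` Y = \<sigma> ` X"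
proof (rule ccontr)
  assume "\<not> ?thesis"
  then have no: "\<And>Y. Y \<subseteq> X \<Longrightarrow> colourable Y 2 \<Longrightarrow> \<sigma> ` Y \<noteq> \<sigma> ` X" by blast
  note full = full_vertex_exists[OF fin pr crit]
  note pair = bipartite_rainbow_or_singleton_class[OF fin pr _ _ _ no]
  obtain c where c: "c \<in> \<sigma> ` X" using k by fastforce
  have "\<not> \<sigma> ` X \<subseteq> {c}" using k card_mono[of "{c}" "\<sigma> ` X"] by auto
  then obtain d where d: "d \<in> \<sigma> ` X" "d \<noteq> c" by blast
  obtain v w where v: "full X \<sigma> v" "\<sigma> v = c" and w: "full X \<sigma> w" "\<sigma> w = d"
    using full[OF c] full[OF d(1)] by blast
  obtain q where q: "q \<in> X" "E v q" "\<And>z. z \<in> X \<Longrightarrow> \<sigma> z = \<sigma> q \<Longrightarrow> z = q"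
    using pair[OF v(1) w(1)] v w d by metis
  have "full X \<sigma> q" using full[of "\<sigma> q"] q unfolding full_def by (metis imageI)
  moreover have "\<sigma> v \<noteq> \<sigma> q" using proper_onD[OF pr _ q(1,2)] v unfolding full_def by blast
  ultimately obtain r where r: "r \<in> X" "E q r" "\<And>z. z \<in> X \<Longrightarrow> \<sigma> z = \<sigma> r \<Longrightarrow> z = r"
    using pair[OF v(1)] by metis
  show False using singleton_classes_not_adjacent[OF fin pr k crit q(1,3) r(1,3)] r(2) by blast
qed

section \<open>Colouring a closed neighbourhood together with a remote set\<close>

text \<open>Number the vertices injectively and mark the larger end of each edge.\<close>

lemma matching_two_colouring:
  assumes "finite T" and T: "matching T"
  shows "\<exists>b :: 'a \<Rightarrow> bool. \<forall>x\<in>T. \<forall>y\<in>T. E x y \<longrightarrow> b x \<noteq> b y"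
proof -
  obtain g :: "'a \<Rightarrow> nat" where g: "inj_on g T"
    using finite_imp_inj_to_nat_seg[OF assms(1)] by metis
  show ?thesis
  proof (intro exI[of _ "\<lambda>x. \<exists>y\<in>T. E x y \<and> g y < g x"] ballI impI)
    fix x y assume xy: "x \<in> T" "y \<in> T" "E x y"
    then have "E y x" "x \<noteq> y" using sym irrefl by blast+
    then have "g x \<noteq> g y" using g xy unfolding inj_on_def by blast
    moreover have "(\<exists>z\<in>T. E x z \<and> g z < g x) \<longleftrightarrow> g y < g x"
      using T xy unfolding matching_def by blast
    moreover have "(\<exists>z\<in>T. E y z \<and> g z < g y) \<longleftrightarrow> g x < g y"
      using T xy \<open>E y x\<close> unfolding matching_def by blast
    ultimately show "(\<exists>z\<in>T. E x z \<and> g z < g x) \<noteq> (\<exists>z\<in>T. E y z \<and> g z < g y)" by linarith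
  qed
qed

text \<open>
  \<open>T\<close> gets the colours \<open>0\<close> and \<open>h\<close>. A vertex of \<open>Y\<close> that conflicts with a \<open>0\<close> in \<open>T\<close> has no other
  neighbour in \<open>T\<close>, hence can move to \<open>h\<close>.
\<close>

lemma colourable_closed_neighbourhood_union:
  assumes "finite T" and T: "T \<subseteq> {u. E v u}" and Y: "colourable Y h" "2 \<le> h"
    and vY: "v \<notin> Y" "\<And>y. y \<in> Y \<Longrightarrow> \<not> E v y"
  shows "colourable (insert v (T \<union> Y)) (Suc h)"
proof -
  obtain b :: "'a \<Rightarrow> bool" where b: "\<And>x y. x \<in> T \<Longrightarrow> y \<in> T \<Longrightarrow> E x y \<Longrightarrow> b x \<noteq> b y"
    using matching_two_colouring[OF assms(1) matching_neighbourhood[OF T]] by metis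
  obtain p where p: "proper_on Y p" "p ` Y \<subseteq> {..<h}" using Y(1) unfolding colourable_def by blast
  define M where "M = {y \<in> Y. p y = 0 \<and> (\<exists>t\<in>T. \<not> b t \<and> E y t)}"
  \<comment> \<open>\<open>v\<close> can reuse the colour 1, as it has no neighbour in
    \<open>Y\<close>; the bound \<open>2 \<le> h\<close> keeps 1 apart from the colours 0 and
    \<open>h\<close> of \<open>T\<close>.\<close>
  define \<tau> where "\<tau> x = (if x = v then 1 else if x \<in> T then (if b x then h else 0)
    else if x \<in> M then h else p x)" for x
  have TY: "T \<inter> Y = {}" "v \<notin> T" using T vY irrefl by auto
  have val: "\<tau> v = 1" "\<And>x. x \<in> T \<Longrightarrow> \<tau> x = (if b x then h else 0)"
    "\<And>x. x \<in> Y \<Longrightarrow> \<tau> x = (if x \<in> M then h else p x)"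
    using TY vY unfolding \<tau>_def by auto
  have ph: "p y < h" if "y \<in> Y" for y using that p by auto
  have one: "t = t'" if "y \<in> Y" "t \<in> T" "t' \<in> T" "E y t" "E y t'" for y t t'
    using common_neighbour_unique[of y t v t'] that T vY by blast
  have vv: "\<tau> v \<noteq> \<tau> x" if "x \<in> T \<union> Y" "E v x" for x using that val vY Y(2) by (auto split: if_splits)
  have tt: "\<tau> x \<noteq> \<tau> y" if "x \<in> T" "y \<in> T" "E x y" for x y using that val b[OF that] Y(2) by auto
  have yy: "\<tau> x \<noteq> \<tau> y" if "x \<in> Y" "y \<in> Y" "E x y" for x y
    using that val ph[of x] ph[of y] proper_onD[OF p(1) that] unfolding M_def by auto
  have yt: "\<tau> x \<noteq> \<tau> y" if xy: "x \<in> Y" "y \<in> T" "E x y" for x y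
  proof (cases "b y")
    case True
    then have "x \<notin> M" using one[OF xy(1) _ xy(2) _ xy(3)] unfolding M_def by blast
    then show ?thesis using True val xy ph[of x] by auto
  next
    case False
    then show ?thesis using val xy Y(2) unfolding M_def by auto
  qed
  have "proper_on (insert v (T \<union> Y)) \<tau>"
  proof (rule proper_onI)
    fix x y assume xy: "x \<in> insert v (T \<union> Y)" "y \<in> insert v (T \<union> Y)" "E x y"
    then have "E y x" "x \<noteq> y" using sym irrefl by blast+
    with xy show "\<tau> x \<noteq> \<tau> y" using vv[of x] vv[of y] tt[of x y] yy[of x y] yt[of x y] yt[of y x] by auto
  qed
  moreover have "\<tau> x < Suc h" if "x \<in> insert v (T \<union> Y)" for x
    using that val Y(2) ph[of x] by auto
  then have "\<tau> ` insert v (T \<union> Y) \<subseteq> {..<Suc h}" by blast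
  ultimately show ?thesis unfolding colourable_def by blast
qed

text \<open>A triangle needs three colours, so the general extension would give four. Here
  \<open>v\<close> and \<open>p\<close> share 0, \<open>q\<close> and \<open>r\<close> take 1 and 2,
  and the colours 1 and 2 on the matching \<open>T\<close> are chosen to fit.\<close>

lemma colourable_closed_neighbourhood_union_triangle:
  assumes "finite T" and T: "T \<subseteq> {u. E v u}"
    and tri: "E p q" "E q r" "E p r" and v: "v \<notin> {p, q, r}" "\<not> E v p" "\<not> E v q" "\<not> E v r"
  shows "colourable (insert v (T \<union> {p, q, r})) 3"
proof -
  have mT: "matching T" using matching_neighbourhood[OF T] .
  obtain b :: "'a \<Rightarrow> bool" where b: "\<And>x y. x \<in> T \<Longrightarrow> y \<in> T \<Longrightarrow> E x y \<Longrightarrow> b x \<noteq> b y"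
    using matching_two_colouring[OF assms(1) mT] by metis
  have pqr: "p \<noteq> q" "q \<noteq> r" "p \<noteq> r" using tri irrefl by blast+
  have TN: "v \<notin> T" "p \<notin> T" "q \<notin> T" "r \<notin> T" using T v irrefl by auto
  have U1: "\<not> (E x q \<and> E x r)" if "x \<in> T" for x
    using common_neighbour_unique[of x q p r] tri pqr TN that by blast
  have U2: "x = y" if "x \<in> T" "y \<in> T" "E x q \<and> E y q \<or> E x r \<and> E y r" for x y
    using common_neighbour_unique[of v x q y] common_neighbour_unique[of v x r y] that T v sym by blast
  have U3: "\<not> (E x q \<and> E y r)" if "x \<in> T" "y \<in> T" "E x y" for x y
    using common_neighbour_unique[of x q y r] c4[of x q r y] that TN tri sym by blast
  \<comment> \<open>\<open>Q\<close> marks the vertices of \<open>T\<close> forced to colour 2 and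
    \<open>R\<close> those forced to 1, by \<open>q\<close> or \<open>r\<close> directly or through
    their partner in \<open>T\<close>. Uniqueness of common neighbours excludes both at once;
    \<open>b\<close> settles the rest.\<close>
  define Q where "Q x \<longleftrightarrow> E x q \<or> (\<exists>y\<in>T. E x y \<and> E y r)" for x
  define R where "R x \<longleftrightarrow> E x r \<or> (\<exists>y\<in>T. E x y \<and> E y q)" for x
  define b' where "b' x \<longleftrightarrow> Q x \<or> \<not> R x \<and> b x" for x
  have b'q: "b' x" if "E x q" for x using that unfolding b'_def Q_def by blast
  have b'r: "\<not> b' x" if "x \<in> T" "E x r" for x
    using that U1 U2 irrefl unfolding b'_def Q_def R_def by metis
  have b': "b' x \<noteq> b' y" if xy: "x \<in> T" "y \<in> T" "E x y" for x y
  proof -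
    have yx: "E y x" "x \<noteq> y" using xy sym irrefl by blast+
    have "Q x \<longleftrightarrow> E x q \<or> E y r" "R x \<longleftrightarrow> E x r \<or> E y q" "Q y \<longleftrightarrow> E y q \<or> E x r" "R y \<longleftrightarrow> E y r \<or> E x q"
      using mT xy yx(1) unfolding Q_def R_def matching_def by blast+
    then show ?thesis using U1[OF xy(1)] U1[OF xy(2)] U2[OF xy(1,2)] yx(2) U3[OF xy] U3[OF xy(2,1) yx(1)] b[OF xy]
      unfolding b'_def by blast
  qed
  define \<tau> :: "'a \<Rightarrow> nat" where "\<tau> x = (if x \<in> T then (if b' x then 2 else 1)
    else if x = q then 1 else if x = r then 2 else 0)" for x
  have "\<tau> x \<noteq> \<tau> y" if xy: "x \<in> insert v (T \<union> {p, q, r})" "y \<in> insert v (T \<union> {p, q, r})" "E x y" for x y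
  proof -
    have yx: "E y x" using xy sym by blast
    consider "x \<in> T" "y \<in> T" | "x \<in> T" "y \<notin> T" | "x \<notin> T" "y \<in> T" | "x \<notin> T" "y \<notin> T" by blast
    then show ?thesis
    proof cases
      case 1
      then show ?thesis using b'[OF _ _ xy(3)] unfolding \<tau>_def by simp
    next
      case 2
      then show ?thesis using xy b'q[of x] b'r[of x] unfolding \<tau>_def by auto
    next
      case 3
      then show ?thesis using xy yx b'q[of y] b'r[of y] unfolding \<tau>_def by auto
    next
      case 4
      then show ?thesis using xy yx v irrefl pqr unfolding \<tau>_def by auto
    qed
  qed
  then have "proper_on (insert v (T \<union> {p, q, r})) \<tau>" by (rule proper_onI)
  moreover have "\<tau> ` insert v (T \<union> {p, q, r}) \<subseteq> {..<3}" unfolding \<tau>_def by auto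
  ultimately show ?thesis unfolding colourable_def by blast
qed

section \<open>Dissolving the class of a vertex that sees most colours\<close>

text \<open>The classes with colours in \<open>D\<close> are kept. A vertex of the colour of
  \<open>v\<close> that misses some \<open>e\<close> in \<open>D\<close> joins the class of
  \<open>e\<close>; one that sees all of \<open>D\<close> has no neighbour in \<open>X'\<close>, by
  the choice of \<open>v\<close>, and takes the colour 0 of \<open>X'\<close>.\<close>

lemma colourable_rainbow_star_extension:
  fixes v :: 'a
  assumes fin: "finite X" and pr: "proper_on X \<sigma>" and v: "v \<in> X"
    and max: "\<And>w. w \<in> X \<Longrightarrow> card (\<sigma> ` {u \<in> X. E w u}) \<le> card (\<sigma> ` {u \<in> X. E v u})"
    and rest: "{x \<in> X. \<sigma> x \<notin> insert (\<sigma> v) (\<sigma> ` {u \<in> X. E v u})} \<noteq> {}"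
    and col: "colourable {x \<in> X. \<sigma> x \<notin> insert (\<sigma> v) (\<sigma> ` {u \<in> X. E v u})} i"
  shows "colourable X (i + card (\<sigma> ` {u \<in> X. E v u}))"
proof -
  define D where "D = \<sigma> ` {u \<in> X. E v u}"
  define X' where "X' = {x \<in> X. \<sigma> x \<notin> insert (\<sigma> v) D}"
  have finD: "finite D" unfolding D_def using fin by simp
  have vD: "\<sigma> v \<notin> D" unfolding D_def using proper_onD[OF pr v] by auto
  obtain p where p: "proper_on X' p" "\<And>x. x \<in> X' \<Longrightarrow> p x < i"
    using col unfolding colourable_def X'_def D_def by blast
  obtain x0 where "x0 \<in> X'" using rest unfolding X'_def D_def by blast
  \<comment> \<open>With \<open>i = 0\<close>, the colour 0 used in \<open>t\<close> could clash
    with a colour given to a class of \<open>D\<close>.\<close>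
  then have i: "0 < i" using p(2) by fastforce
  obtain g where g: "bij_betw g D {..<card D}"
    using ex_bij_betw_finite_nat[OF finD] by (auto simp: atLeast0LessThan)
  have g_less: "g e < card D" if "e \<in> D" for e using that g bij_betwE by blast
  have g_inj: "g e \<noteq> g e'" if "e \<in> D" "e' \<in> D" "e \<noteq> e'" for e e'
    using that g unfolding bij_betw_def inj_on_def by blast
  have "\<exists>t. t = 0 \<and> (\<forall>u\<in>X'. \<not> E x u) \<or> (\<exists>e\<in>D. t = i + g e \<and> (\<forall>u\<in>X. E x u \<longrightarrow> \<sigma> u \<noteq> e))"
    if x: "x \<in> X" for x
  proof (cases "\<exists>e\<in>D. \<forall>u\<in>X. E x u \<longrightarrow> \<sigma> u \<noteq> e")
    case True
    then show ?thesis by blast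
  next
    case False
    have "\<not> E x u" if u: "u \<in> X'" for u
    proof
      assume "E x u"
      then have "\<sigma> u \<in> \<sigma> ` {u \<in> X. E x u}" using u unfolding X'_def by blast
      moreover have "D \<subseteq> \<sigma> ` {u \<in> X. E x u}"
      proof
        fix e assume "e \<in> D"
        then obtain w where "w \<in> X" "E x w" "\<sigma> w = e" using False by blast
        then show "e \<in> \<sigma> ` {u \<in> X. E x u}" by blast
      qed
      ultimately have "insert (\<sigma> u) D \<subseteq> \<sigma> ` {u \<in> X. E x u}" by blast
      then have "card (insert (\<sigma> u) D) \<le> card (\<sigma> ` {u \<in> X. E x u})"
        using fin by (intro card_mono) auto
      also have "\<dots> \<le> card D" using max[OF x] unfolding D_def .
      finally have "card (insert (\<sigma> u) D) \<le> card D" .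
      then show False using u finD unfolding X'_def by simp
    qed
    then show ?thesis by blast
  qed
  then obtain t where t: "\<And>x. x \<in> X \<Longrightarrow> t x = 0 \<and> (\<forall>u\<in>X'. \<not> E x u) \<or>
      (\<exists>e\<in>D. t x = i + g e \<and> (\<forall>u\<in>X. E x u \<longrightarrow> \<sigma> u \<noteq> e))"
    by metis
  define \<tau> where "\<tau> x = (if x \<in> X' then p x else if \<sigma> x \<in> D then i + g (\<sigma> x) else t x)" for x
  have cases: "x \<in> X' \<and> \<tau> x = p x \<or> \<sigma> x \<in> D \<and> \<tau> x = i + g (\<sigma> x) \<or> \<sigma> x = \<sigma> v \<and> \<tau> x = t x"
    if "x \<in> X" for x
    using that vD unfolding \<tau>_def X'_def by auto
  have t1: "t x \<noteq> p y" if "x \<in> X" "y \<in> X'" "E x y" for x y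
    using t[OF that(1)] that p(2)[OF that(2)] by auto
  have t2: "t x \<noteq> i + g (\<sigma> y)" if "x \<in> X" "y \<in> X" "\<sigma> y \<in> D" "E x y" for x y
    using t[OF that(1)] that i g_inj by auto
  have "proper_on X \<tau>"
  proof (rule proper_onI)
    fix x y assume xy: "x \<in> X" "y \<in> X" "E x y"
    then have "E y x" "\<sigma> x \<noteq> \<sigma> y" using sym proper_onD[OF pr] by blast+
    with xy show "\<tau> x \<noteq> \<tau> y"
      using cases[OF xy(1)] cases[OF xy(2)] t1[of x y] t1[of y x] t2[of x y] t2[of y x]
        p(2)[of x] p(2)[of y] proper_onD[OF p(1), of x y] g_inj[of "\<sigma> x" "\<sigma> y"]
      by auto
  qed
  moreover have "\<tau> x < i + card D" if "x \<in> X" for x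
    using cases[OF that] t[OF that] p(2)[of x] g_less i by fastforce
  then have "\<tau> ` X \<subseteq> {..<i + card D}" by blast
  ultimately show ?thesis unfolding colourable_def D_def by blast
qed

section \<open>Three colours, and the induction\<close>

text \<open>Three vertices of distinct colours work unless they form a triangle. Then a further
  vertex \<open>w\<close> replaces the one of its colour: adjacency to both others would close a
  4-cycle through the replaced vertex.\<close>

lemma bipartite_rainbow_three:
  assumes fin: "finite X" and k: "card (\<sigma> ` X) = 3"
    and tri: "\<not> (card X = 3 \<and> (\<forall>x\<in>X. \<forall>y\<in>X. x \<noteq> y \<longrightarrow> E x y))"
  shows "\<exists>Y\<subseteq>X. colourable Y 2 \<and> \<sigma> ` Y = \<sigma> ` X"
proof -
  obtain T where T: "T \<subseteq> X" "inj_on \<sigma> T" "\<sigma> ` T = \<sigma> ` X"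
    using subset_image_inj[of "\<sigma> ` X" \<sigma> X] by auto
  then have cT: "card T = 3" using k card_image by fastforce
  have two: "colourable {a, b, c} 2" if "\<not> E a b" for a b c
    using colourable_two[of "{a, b}" "{c}"] that sym irrefl unfolding indep_def by (auto simp: insert_commute)
  show ?thesis
  proof (cases "\<forall>x\<in>T. \<forall>y\<in>T. x \<noteq> y \<longrightarrow> E x y")
    case False
    then obtain a b where ab: "a \<in> T" "b \<in> T" "a \<noteq> b" "\<not> E a b" by blast
    have "card (T - {a, b}) = 1" using ab cT by (simp add: card_Diff_subset)
    then obtain c where "T - {a, b} = {c}" by (auto simp: card_1_singleton_iff)
    then have "T = {a, b, c}" using ab by blast
    then show ?thesis using two[OF ab(4), of c] T by blast
  next
    case True
    then have "T \<noteq> X" using tri cT by blast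
    then obtain w where w: "w \<in> X" "w \<notin> T" using T by blast
    then obtain a where a: "a \<in> T" "\<sigma> a = \<sigma> w" using T by (metis imageE imageI)
    have "card (T - {a}) = 2" using a cT by simp
    then obtain b c where bc: "T - {a} = {b, c}" "b \<noteq> c" by (auto simp: card_2_iff)
    then have Tabc: "T = {a, b, c}" "a \<noteq> b" "a \<noteq> c" using a by blast+
    have "\<not> (E w b \<and> E w c)"
      using common_neighbour_unique[of w b a c] True Tabc bc w by blast
    then have "colourable {w, b, c} 2" using two[of w b c] two[of w c b] by (auto simp: insert_commute)
    moreover have "\<sigma> ` {w, b, c} = \<sigma> ` X" using T(3) a(2) Tabc by auto
    moreover have "{w, b, c} \<subseteq> X" using T(1) Tabc w by auto
    ultimately show ?thesis by blast
  qed
qed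

text \<open>\<open>h\<close> and \<open>j\<close> bound the chromatic numbers on \<open>Y\<close>
  and \<open>X\<close> from above, so the inequality yields the discrepancy bound for
  \<open>\<sigma>\<close> without computing either number.\<close>

lemma discrepancy_witness:
  assumes "finite X" and "X \<noteq> {}" and "proper_on X \<sigma>"
    and "\<not> (card X = 3 \<and> (\<forall>x\<in>X. \<forall>y\<in>X. x \<noteq> y \<longrightarrow> E x y))"
  shows "\<exists>Y\<subseteq>X. Y \<noteq> {} \<and> (\<exists>h j. colourable Y h \<and> colourable X j \<and> h + j \<le> card (\<sigma> ` Y) + 2)"
  using assms
proof (induction X rule: finite_psubset_induct)
  case (psubset X)
  note fin = psubset.hyps(1) and ne = psubset.prems(1) and pr = psubset.prems(2) and tri = psubset.prems(3)
  let ?k = "card (\<sigma> ` X)"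
  have colk: "colourable X ?k" using colourable_card[OF fin pr] by blast
  have k1: "1 \<le> ?k" using fin ne by (simp add: Suc_le_eq card_gt_0_iff)
  show ?case
  proof (cases "colourable X (?k - 1)")
    case False
    show ?thesis
    proof (cases "?k \<le> 2")
      case True
      obtain x where x: "x \<in> X" using ne by blast
      have "colourable {x} 1" using colourable_insert[of "{}" 0 x] unfolding colourable_def proper_on_def by simp
      moreover have "1 + ?k \<le> card (\<sigma> ` {x}) + 2" using True by simp
      ultimately show ?thesis using x colk by blast
    next
      case k: False
      obtain Y where Y: "Y \<subseteq> X" "colourable Y 2" "\<sigma> ` Y = \<sigma> ` X"
      proof (cases "?k = 3")
        case True
        then show thesis using bipartite_rainbow_three[OF fin True tri] that by blast
      next
        case False
        then have "4 \<le> ?k" using k by linarith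
        then show thesis using bipartite_rainbow_exists[OF fin pr _ \<open>\<not> colourable X (?k - 1)\<close>] that by blast
      qed
      moreover have "Y \<noteq> {}" using Y(3) ne by auto
      moreover have "2 + ?k \<le> card (\<sigma> ` Y) + 2" using Y(3) by simp
      ultimately show ?thesis using colk by blast
    qed
  next
    case slack: True
    define f where "f w = card (\<sigma> ` {u \<in> X. E w u})" for w
    have "Max (f ` X) \<in> f ` X" using fin ne by simp
    then obtain v where v: "v \<in> X" "f v = Max (f ` X)" by auto
    have max: "f w \<le> f v" if "w \<in> X" for w using that v fin by simp
    define N where "N = {u \<in> X. E v u}"
    define D where "D = \<sigma> ` N"
    define X' where "X' = {x \<in> X. \<sigma> x \<notin> insert (\<sigma> v) D}"
    have finN: "finite N" "finite D" unfolding D_def N_def using fin by simp_all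
    have NE: "N \<subseteq> {u. E v u}" unfolding N_def by blast
    have vD: "\<sigma> v \<notin> D" unfolding D_def N_def using proper_onD[OF pr v(1)] by auto
    have X': "v \<notin> X'" "\<And>y. y \<in> X' \<Longrightarrow> \<not> E v y" "X' \<subset> X"
      using v(1) unfolding X'_def D_def N_def by auto
    have union: "colourable (insert v (N \<union> Y)) (Suc h)" if "Y \<subseteq> X'" "colourable Y h" "2 \<le> h" for Y h
      using colourable_closed_neighbourhood_union[OF finN(1) NE that(2,3)] X' that(1) by blast
    \<comment> \<open>All colours are present here, and the colour saved by \<open>slack\<close>
      pays for the third class: \<open>3 + (?k - 1) = ?k + 2\<close>.\<close>
    have all: ?thesis if Y: "Y \<subseteq> X'" "\<sigma> ` Y = \<sigma> ` X'" "colourable (insert v (N \<union> Y)) 3" for Y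
    proof -
      have "\<sigma> ` insert v (N \<union> Y) = \<sigma> ` insert v (N \<union> X')" using Y(2) by auto
      also have "\<dots> = \<sigma> ` X" using v(1) unfolding X'_def D_def N_def by auto
      finally have "3 + (?k - 1) \<le> card (\<sigma> ` insert v (N \<union> Y)) + 2" using k1 by simp
      moreover have "insert v (N \<union> Y) \<subseteq> X" using Y(1) v(1) unfolding X'_def N_def by blast
      ultimately show ?thesis using Y(3) slack by blast
    qed
    consider "X' = {}" | "X' \<noteq> {}" "card X' = 3 \<and> (\<forall>x\<in>X'. \<forall>y\<in>X'. x \<noteq> y \<longrightarrow> E x y)"
      | "X' \<noteq> {}" "\<not> (card X' = 3 \<and> (\<forall>x\<in>X'. \<forall>y\<in>X'. x \<noteq> y \<longrightarrow> E x y))" by blast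
    then show ?thesis
    proof cases
      case 1
      have "colourable {} 2" unfolding colourable_def proper_on_def by simp
      then show ?thesis using union[of "{}" 2] all[of "{}"] 1 by simp
    next
      case 2
      then obtain p q r where pqr: "X' = {p, q, r}" "p \<noteq> q" "q \<noteq> r" "p \<noteq> r"
        by (auto simp: card_3_iff)
      have "colourable (insert v (N \<union> {p, q, r})) 3"
        using 2 pqr X' by (intro colourable_closed_neighbourhood_union_triangle[OF finN(1) NE]) auto
      then show ?thesis using all[of X'] pqr(1) by simp
    next
      case 3
      have "proper_on X' \<sigma>" using pr X'(3) unfolding proper_on_def by blast
      from psubset.IH[OF X'(3) 3(1) this 3(2)] obtain Y h j where
        Y: "Y \<subseteq> X'" "Y \<noteq> {}" "colourable Y h" "colourable X' j" "h + j \<le> card (\<sigma> ` Y) + 2" by blast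
      have colX: "colourable X (j + card D)"
        using colourable_rainbow_star_extension[OF fin pr v(1)] max 3(1) Y(4)
        unfolding f_def X'_def D_def N_def by blast
      \<comment> \<open>Adding \<open>v\<close> and \<open>N\<close> to \<open>Z\<close> brings
        \<open>card D + 1\<close> new colours. This balances one more class for the subset and
        \<open>card D\<close> more for the whole graph.\<close>
      have step: ?thesis if Z: "Z \<subseteq> X'" "colourable Z l" "2 \<le> l" "l + j \<le> card (\<sigma> ` Z) + 2" for Z l
      proof -
        have "\<sigma> ` insert v (N \<union> Z) = insert (\<sigma> v) D \<union> \<sigma> ` Z" unfolding D_def by auto
        moreover have "finite Z" using Z(1) X'(3) fin by (meson finite_subset psubset_imp_subset)
        then have "card (insert (\<sigma> v) D \<union> \<sigma> ` Z) = card (insert (\<sigma> v) D) + card (\<sigma> ` Z)"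
          using Z(1) finN(2) unfolding X'_def by (intro card_Un_disjoint) auto
        ultimately have "card (\<sigma> ` insert v (N \<union> Z)) = Suc (card D) + card (\<sigma> ` Z)"
          using vD finN(2) by simp
        then have "Suc l + (j + card D) \<le> card (\<sigma> ` insert v (N \<union> Z)) + 2" using Z(4) by simp
        moreover have "insert v (N \<union> Z) \<subseteq> X" using Z(1) v(1) unfolding X'_def N_def by blast
        ultimately show ?thesis using union[OF Z(1-3)] colX by blast
      qed
      have "h \<noteq> 0" using Y(2,3) unfolding colourable_def by auto
      \<comment> \<open>\<open>union\<close> needs \<open>2 \<le> h\<close>. If
        \<open>h = 1\<close>, either \<open>Y\<close> has all colours of \<open>X'\<close>, or a
        vertex of a new colour raises both \<open>h\<close> and the number of colours by
        one.\<close>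
      then consider "2 \<le> h" | "h = 1" "\<sigma> ` Y = \<sigma> ` X'" | "h = 1" "\<sigma> ` Y \<noteq> \<sigma> ` X'" by linarith
      then show ?thesis
      proof cases
        case 1
        then show ?thesis using step Y by blast
      next
        case 2
        then have "colourable Y 2" using colourable_mono[OF Y(3), of Y 2] by simp
        then show ?thesis using union[of Y 2] all[of Y] Y(1) 2(2) by simp
      next
        case 3
        then obtain z where z: "z \<in> X'" "\<sigma> z \<notin> \<sigma> ` Y" using Y(1) by blast
        have "finite Y" using Y(1) X'(3) fin by (meson finite_subset psubset_imp_subset)
        then have "card (\<sigma> ` insert z Y) = Suc (card (\<sigma> ` Y))" using z(2) by simp
        then show ?thesis using step[of "insert z Y" 2] colourable_insert[OF Y(3), of z] Y(1,5) z(1) 3(1)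
          by (simp add: numeral_2_eq_2)
      qed
    qed
  qed
qed

end

section \<open>Transfer to digraphs and their induced subgraphs\<close>

theorem theorem1p10:
  fixes G :: "('a, 'b) pre_digraph"
  assumes "graph G" and "verts G \<noteq> {}"
    and "c4_free G"
    and "\<not> complete_digraph 3 G"
  shows "chromatic_discrepancy G \<ge> int (chromatic_number G) - 2"
proof -
  interpret graph G by fact
  have free: "\<not> (\<exists>a b c d. distinct [a, b, c, d] \<and>
      a \<rightarrow>\<^bsub>G\<^esub> b \<and> b \<rightarrow>\<^bsub>G\<^esub> c \<and> c \<rightarrow>\<^bsub>G\<^esub> d \<and> d \<rightarrow>\<^bsub>G\<^esub> a)"
    using assms(3) unfolding c4_free_iff .
  interpret c4_free_relation "\<lambda>u v. u \<rightarrow>\<^bsub>G\<^esub> v"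
  proof
    show "y \<rightarrow>\<^bsub>G\<^esub> x" if "x \<rightarrow>\<^bsub>G\<^esub> y" for x y using arcs_ends_symmetric[OF sym_arcs that] .
    show irrefl: "\<not> x \<rightarrow>\<^bsub>G\<^esub> x" for x using adj_not_same by blast
    show "a = c \<or> b = d" if "a \<rightarrow>\<^bsub>G\<^esub> b" "b \<rightarrow>\<^bsub>G\<^esub> c" "c \<rightarrow>\<^bsub>G\<^esub> d" "d \<rightarrow>\<^bsub>G\<^esub> a" for a b c d
    proof (rule ccontr)
      assume "\<not> (a = c \<or> b = d)"
      then have "distinct [a, b, c, d]" using that irrefl by auto
      with free that show False by blast
    qed
  qed
  have chi: "chromatic_number H \<le> n"
    if H: "\<And>u v. u \<rightarrow>\<^bsub>H\<^esub> v \<Longrightarrow> u \<in> verts H \<and> v \<in> verts H \<and> u \<rightarrow>\<^bsub>G\<^esub> v" and col: "colourable (verts H) n"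
    for H :: "('a, 'b) pre_digraph" and n
  proof -
    obtain \<tau> where \<tau>: "proper_on (verts H) \<tau>" "\<tau> ` verts H \<subseteq> {..<n}"
      using col unfolding colourable_def by blast
    have "proper_colouring H \<tau>"
      unfolding proper_colouring_def using H proper_onD[OF \<tau>(1)] by blast
    then have "chromatic_number H \<le> card (\<tau> ` verts H)"
      unfolding chromatic_number_def by (intro Least_le) blast
    also have "\<dots> \<le> n" using card_mono[OF _ \<tau>(2)] by simp
    finally show ?thesis .
  qed
  have "\<not> (card (verts G) = 3 \<and> (\<forall>x\<in>verts G. \<forall>y\<in>verts G. x \<noteq> y \<longrightarrow> x \<rightarrow>\<^bsub>G\<^esub> y))"
  proof
    assume "card (verts G) = 3 \<and> (\<forall>x\<in>verts G. \<forall>y\<in>verts G. x \<noteq> y \<longrightarrow> x \<rightarrow>\<^bsub>G\<^esub> y)"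
    moreover from this have "arcs_ends G = {(u, v). (u, v) \<in> verts G \<times> verts G \<and> u \<noteq> v}"
      by (auto dest: adj_in_verts simp: irrefl)
    ultimately show False using assms(1,4) unfolding complete_digraph_def by blast
  qed
  note witness = discrepancy_witness[OF finite_verts assms(2) _ this]
  have "int (chromatic_number G) - 2 \<le> colouring_discrepancy G \<sigma>" if \<sigma>: "proper_colouring G \<sigma>" for \<sigma>
  proof -
    have "proper_on (verts G) \<sigma>" using \<sigma> unfolding proper_colouring_def proper_on_def by blast
    from witness[OF this] obtain Y h j where Y: "Y \<subseteq> verts G" "Y \<noteq> {}" "colourable Y h"
      "colourable (verts G) j" "h + j \<le> card (\<sigma> ` Y) + 2" by blast
    have vY: "verts (G \<restriction> Y) = Y" by simp
    have "chromatic_number (G \<restriction> Y) \<le> h"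
    proof (rule chi)
      show "u \<in> verts (G \<restriction> Y) \<and> v \<in> verts (G \<restriction> Y) \<and> u \<rightarrow>\<^bsub>G\<^esub> v" if "u \<rightarrow>\<^bsub>G \<restriction> Y\<^esub> v" for u v
        using that by (auto simp: arcs_ends_conv)
    qed (simp add: Y(3))
    moreover have "chromatic_number G \<le> j" using chi[OF _ Y(4)] adj_in_verts by blast
    moreover have "int (card (\<sigma> ` verts (G \<restriction> Y))) - int (chromatic_number (G \<restriction> Y)) \<le> colouring_discrepancy G \<sigma>"
      unfolding colouring_discrepancy_def
    proof (rule Max_ge[OF finite_discrepancy_candidates])
      have "induced_subgraph (G \<restriction> Y) G" using Y(1) by (rule induced_induce)
      then show "int (card (\<sigma> ` verts (G \<restriction> Y))) - int (chromatic_number (G \<restriction> Y))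
          \<in> {int (card (\<sigma> ` verts H)) - int (chromatic_number H) |H. induced_subgraph H G \<and> verts H \<noteq> {}}"
        using Y(2) vY by blast
    qed
    ultimately show ?thesis using Y(5) vY by simp
  qed
  then show ?thesis unfolding chromatic_discrepancy_def
    using Min_ge_iff[OF finite_colouring_discrepancies[OF assms(2)] colouring_discrepancies_nonempty] by blast
qed

end
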